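(* Let $\mathbb K=\mathbb C$ or $\mathbb K=\mathbb R$ and let $A\in\mathbb K^{n\times n}$ have all distinct eigenvalues. Let $r(\varepsilon)$, $\varepsilon\in[\underline\varepsilon,\overline\varepsilon]$ with $0<\underline\varepsilon<\overline\varepsilon$, be a branch of minima (as defined in the context) such that $r(\varepsilon)>0$ for all $\varepsilon$, so that $\lambda(\varepsilon)$ is a simple eigenvalue of $A+\varepsilon E(\varepsilon)$, where $E(\varepsilon)\in\mathbb K^{n\times n}$ is a minimizer depending smoothly on $\varepsilon$; that is, $\lambda(\varepsilon)\in\Lambda(A+\varepsilon E(\varepsilon))$ with $\|E(\varepsilon)\|_F=1$ for all $\varepsilon$. For all $\varepsilon$, let $x(\varepsilon)$ and $y(\varepsilon)$ be smooth vector-valued functions giving right and left eigenvectors of $A+\varepsilon E(\varepsilon)$ (associated to $\lambda(\varepsilon)$) of unit norm and such that $y(\varepsilon)^Hx(\varepsilon)>0$, and let $G(\varepsilon)$ be the group inverse of $A+\varepsilon E(\varepsilon)-\lambda(\varepsilon)I$. Then $$\frac{\mathrm d r(\varepsilon)}{\mathrm d\varepsilon}=r(\varepsilon)\,\mathrm{Re}\Big(x(\varepsilon)^HG(\varepsilon)E(\varepsilon)x(\varepsilon)+y(\varepsilon)^HE(\varepsilon)G(\varepsilon)y(\varepsilon)\Big)\le0 .$$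
   Context: $\Lambda(M)$ denotes the spectrum of $M$, $\|\cdot\|_F$ the Frobenius norm. For given $\varepsilon$, $$r(\varepsilon)=\min_{E\in\mathbb K^{n\times n},\ \|E\|_F=1} y^Hx,$$ where $x$ and $y$ are right and left eigenvectors of $A+\varepsilon E$ belonging to the same eigenvalue, with $\|x\|_2=\|y\|_2=1$ and scaled so that $y^Hx\ge0$. A branch of minima with smooth minimizer $E(\varepsilon)$ means: for each $\varepsilon$ in the interval the minimum is attained at $E(\varepsilon)$, with the eigenvalue $\lambda(\varepsilon)$ of $A+\varepsilon E(\varepsilon)$ and corresponding eigenvectors $x(\varepsilon),y(\varepsilon)$, so $r(\varepsilon)=y(\varepsilon)^Hx(\varepsilon)$. Left eigenvectors satisfy $y^HM=\lambda y^H$. For a singular matrix $M$ with a simple zero eigenvalue, its group inverse is the unique $G$ with $MG=GM$, $GMG=G$, $MGM=M$. *)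

theory Defs
  imports "HOL-Analysis.Analysis"
begin

text \<open>
  Matrices over the real or complex field are complex matrices all of whose entries lie in
  \<open>K\<close>, where \<open>K\<close> is \<open>UNIV\<close> or \<open>\<real>\<close>; eigenvalues and eigenvectors are complex in both cases.
  The norm of the type \<open>complex^'n\<close> is the Euclidean norm, and that of \<open>complex^'n^'n\<close> is
  the Frobenius norm.
\<close>

definition entries_in :: "complex set \<Rightarrow> complex^'n^'m \<Rightarrow> bool" where
  "entries_in K M \<longleftrightarrow> (\<forall>i j. M $ i $ j \<in> K)"

definition spectrum :: "complex^'n^'n \<Rightarrow> complex set" where
  "spectrum M = {\<mu>. \<exists>v. v \<noteq> 0 \<and> M *v v = \<mu> *s v}"

definition vcnj :: "complex^'n \<Rightarrow> complex^'n" where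
  "vcnj v = (\<chi> i. cnj (v $ i))"

definition hprod :: "complex^'n \<Rightarrow> complex^'n \<Rightarrow> complex" where
  \<comment> \<open>\<open>y\<^sup>H x\<close>, conjugate-linear in the first argument\<close>
  "hprod y x = (\<Sum>i\<in>UNIV. cnj (y $ i) * x $ i)"

definition unit_eigenvectors ::
  "complex^'n^'n \<Rightarrow> complex \<Rightarrow> complex^'n \<Rightarrow> complex^'n \<Rightarrow> bool" where
  \<comment> \<open>right eigenvector \<open>x\<close> and left eigenvector \<open>y\<close>, i.e. \<open>M x = \<mu> x\<close> and \<open>y\<^sup>H M = \<mu> y\<^sup>H\<close>\<close>
  "unit_eigenvectors M \<mu> x y \<longleftrightarrow>
     M *v x = \<mu> *s x \<and> vcnj y v* M = \<mu> *s vcnj y \<and> norm x = 1 \<and> norm y = 1"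

definition eigenvector_products :: "complex set \<Rightarrow> complex^'n^'n \<Rightarrow> real \<Rightarrow> real set" where
  "eigenvector_products K A \<epsilon> =
     {s. s \<ge> 0 \<and> (\<exists>E \<mu> x y. entries_in K E \<and> norm E = 1 \<and>
            unit_eigenvectors (A + \<epsilon> *\<^sub>R E) \<mu> x y \<and> hprod y x = of_real s)}"

text \<open>
  The minimum \<open>r(\<epsilon>)\<close>, taken over \<open>E\<close> and over all pairs of unit eigenvectors of \<open>A + \<epsilon> E\<close>
  belonging to a common eigenvalue.  It is written as an infimum; the branches below
  require it to be attained.
\<close>

definition rmin :: "complex set \<Rightarrow> complex^'n^'n \<Rightarrow> real \<Rightarrow> real" where
  "rmin K A \<epsilon> = Inf (eigenvector_products K A \<epsilon>)"

text \<open>Infinitely often differentiable on \<open>S\<close>, one-sided at the endpoints of an interval.\<close>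

definition smooth_on :: "real set \<Rightarrow> (real \<Rightarrow> 'a::real_normed_vector) \<Rightarrow> bool" where
  "smooth_on S f \<longleftrightarrow> (\<exists>D :: nat \<Rightarrow> real \<Rightarrow> 'a. D 0 = f \<and>
     (\<forall>k. \<forall>t\<in>S. (D k has_vector_derivative D (Suc k) t) (at t within S)))"

definition branch_of_minima ::
  "complex set \<Rightarrow> complex^'n^'n \<Rightarrow> real set \<Rightarrow> (real \<Rightarrow> complex^'n^'n) \<Rightarrow> (real \<Rightarrow> complex) \<Rightarrow> bool" where
  "branch_of_minima K A I E l \<longleftrightarrow> smooth_on I E \<and>
     (\<forall>\<epsilon>\<in>I. entries_in K (E \<epsilon>) \<and> norm (E \<epsilon>) = 1 \<and>
        (\<exists>x y. unit_eigenvectors (A + \<epsilon> *\<^sub>R E \<epsilon>) (l \<epsilon>) x y \<and>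
               hprod y x = of_real (rmin K A \<epsilon>)))"

definition is_group_inverse :: "complex^'n^'n \<Rightarrow> complex^'n^'n \<Rightarrow> bool" where
  "is_group_inverse M G \<longleftrightarrow> M ** G = G ** M \<and> G ** M ** G = G \<and> M ** G ** M = M"

lemma is_group_inverse_unique:
  assumes "is_group_inverse M G" "is_group_inverse M H"
  shows "G = H"
proof -
  have g: "M ** G = G ** M" "G ** M ** G = G" "M ** G ** M = M"
    and h: "M ** H = H ** M" "H ** M ** H = H" "M ** H ** M = M"
    using assms unfolding is_group_inverse_def by blast+
  have "M ** G = H ** M ** M ** G" by (metis g(1) h(1,3))
  also have "\<dots> = H ** (M ** G ** M)" by (metis g(1) matrix_mul_assoc)
  also have "\<dots> = H ** M" using g(3) by simp
  finally have *: "M ** G = H ** M" .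
  have "G = H ** M ** G" by (metis * g(1,2))
  also have "\<dots> = H ** M ** H" by (metis * h(1) matrix_mul_assoc)
  also have "\<dots> = H" by (rule h(2))
  finally show ?thesis .
qed

definition group_inverse :: "complex^'n^'n \<Rightarrow> complex^'n^'n" where
  "group_inverse M = (THE G. is_group_inverse M G)"

end

theory Submission
  imports Defs
begin

text \<open>
  On the branch, \<open>r(\<epsilon>) = y\<^sup>H x\<close> for the given unit eigenvectors: a positive minimum rules out
  orthogonal left and right eigenvectors, hence multiple eigenvalues, and leaves the eigenvectors
  unique up to a phase (\<open>minimizer_simple_eigentriple\<close>).  Differentiating the two eigenvector
  equations and solving them with the group inverse gives, for a matrix moving with velocity \<open>H\<close>,
  the logarithmic derivative \<open>S(H) = Re (x\<^sup>H G H x + y\<^sup>H H G y)\<close> of \<open>y\<^sup>H x\<close>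
  (\<open>eigenvector_product_variation\<close>).  Here the velocity is \<open>E + \<epsilon> E'\<close>, so the formula
  for \<open>r'\<close> amounts to \<open>S(E') = 0\<close>.

  Both this and the sign of \<open>r'\<close> come from one observation (\<open>rmin_le_on_ball\<close>): eigenvectors do not
  change under \<open>M \<mapsto> M + s I\<close>, and a real shift carries any matrix in the ball of radius \<open>\<epsilon>\<close> about \<open>A\<close>
  to its boundary, within \<open>K\<close>.  So \<open>r(\<epsilon>)\<close> is the infimum over the whole ball.  It therefore cannot
  increase with \<open>\<epsilon>\<close>, which is the sign.  Moreover \<open>A + \<epsilon> E\<close> minimises over the ball, so \<open>S(H) \<ge> 0\<close> for each
  inward direction \<open>H\<close>, and by linearity and passage to the limit \<open>S\<close> vanishes on the tangent space of the
  sphere, which contains \<open>E'\<close> because \<open>\<parallel>E\<parallel> = 1\<close> (\<open>sensitivity_tangent_zero\<close>).  Comparing with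
  inward directions on straight lines, rather than with curves on the sphere, only needs
  differentiable eigenvectors along \<open>M + t H\<close>; the inverse function theorem supplies them
  (\<open>perturbed_right_eigenvector\<close>), for the left eigenvectors through the adjoint matrix.
\<close>

section \<open>Hermitian form and adjoint\<close>

definition cadj :: "complex^'n^'m \<Rightarrow> complex^'m^'n" where
  "cadj M = (\<chi> i j. cnj (M $ j $ i))"

lemma bilinear_hprod: "bilinear hprod"
  unfolding bilinear_def linear_iff hprod_def
  by (auto simp: algebra_simps sum.distrib scaleR_sum_right)

lemma bilinear_mult_vec: "bilinear ((*v) :: complex^'n^'m \<Rightarrow> complex^'n \<Rightarrow> complex^'m)"
  unfolding bilinear_def linear_iff
  by (auto simp: vec_eq_iff matrix_vector_mult_def algebra_simps sum.distrib scaleR_sum_right)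

lemma bilinear_smult: "bilinear ((*s) :: complex \<Rightarrow> complex^'n \<Rightarrow> complex^'n)"
  unfolding bilinear_def linear_iff by (auto simp: vec_eq_iff algebra_simps)

lemmas bounded_bilinear_hprod = bilinear_hprod[unfolded bilinear_conv_bounded_bilinear]
lemmas bounded_bilinear_mult_vec = bilinear_mult_vec[unfolded bilinear_conv_bounded_bilinear]
lemmas bounded_bilinear_smult = bilinear_smult[unfolded bilinear_conv_bounded_bilinear]

lemmas hprod_simps =
  bounded_bilinear.add_left[OF bounded_bilinear_hprod]
  bounded_bilinear.add_right[OF bounded_bilinear_hprod]
  bounded_bilinear.diff_left[OF bounded_bilinear_hprod]
  bounded_bilinear.diff_right[OF bounded_bilinear_hprod]
  bounded_bilinear.zero_left[OF bounded_bilinear_hprod]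
  bounded_bilinear.zero_right[OF bounded_bilinear_hprod]
  bounded_bilinear.scaleR_left[OF bounded_bilinear_hprod]
  bounded_bilinear.scaleR_right[OF bounded_bilinear_hprod]

lemma hprod_smult [simp]:
  "hprod y (c *s x) = c * hprod y x" "hprod (c *s y) x = cnj c * hprod y x"
  by (simp_all add: hprod_def sum_distrib_left mult_ac)

lemma cnj_hprod: "cnj (hprod x y) = hprod y x"
  by (simp add: hprod_def mult.commute)

lemma Re_hprod: "Re (hprod x y) = x \<bullet> y"
  by (simp add: hprod_def inner_vec_def inner_complex_def)

lemma hprod_self: "hprod x x = of_real ((norm x)\<^sup>2)"
proof -
  have "Im (hprod x x) = 0" by (simp add: hprod_def)
  then show ?thesis
    by (simp add: complex_eq_iff Re_hprod power2_norm_eq_inner)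
qed

lemma norm_smult: "norm (c *s v) = cmod c * norm v" for v :: "complex^'n"
  by (simp add: norm_vec_def norm_mult L2_set_right_distrib)

lemma mat_mult_vec: "mat k *v v = k *s v" for v :: "complex^'n"
  by (simp add: vec_eq_iff matrix_vector_mult_def mat_def if_distrib if_distribR cong: if_cong)

lemma scaleR_mult_vec: "(k *\<^sub>R M) *v v = k *\<^sub>R (M *v v)" for v :: "complex^'n"
  by (rule bounded_bilinear.scaleR_left[OF bounded_bilinear_mult_vec])

lemma hprod_cadj: "hprod (cadj M *v y) x = hprod y (M *v x)"
  unfolding hprod_def cadj_def matrix_vector_mult_def
  by (simp add: sum_distrib_left sum_distrib_right mult_ac) (rule sum.swap)

lemma cadj_cadj [simp]: "cadj (cadj M) = M"
  by (simp add: cadj_def vec_eq_iff)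

lemma hprod_cadj_right: "hprod y (cadj M *v x) = hprod (M *v y) x"
  using hprod_cadj[of "cadj M" y x] by simp

lemma linear_cadj: "linear cadj"
  unfolding linear_iff cadj_def by (simp add: vec_eq_iff)

lemma cadj_mat: "cadj (mat k) = mat (cnj k)"
  by (simp add: cadj_def mat_def vec_eq_iff)

lemma cadj_matrix_mult: "cadj (M ** N) = cadj N ** cadj M"
  by (simp add: cadj_def matrix_matrix_mult_def vec_eq_iff mult.commute)

text \<open>
  A left eigenvector of \<open>M\<close> is a right eigenvector of the adjoint, so facts about
  right eigenvectors carry over to left ones.
\<close>

lemma left_eigenvector_iff_cadj:
  "vcnj y v* M = \<mu> *s vcnj y \<longleftrightarrow> cadj M *v y = cnj \<mu> *s y"
proof -
  have "(\<Sum>i\<in>UNIV. M $ i $ j * cnj (y $ i)) = \<mu> * cnj (y $ j) \<longleftrightarrow>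
        (\<Sum>i\<in>UNIV. cnj (M $ i $ j) * y $ i) = cnj \<mu> * y $ j" for j
    by (subst complex_cnj_cancel_iff[symmetric]) simp
  then show ?thesis
    by (simp add: vec_eq_iff vector_matrix_mult_def matrix_vector_mult_def vcnj_def cadj_def
        mult.commute[of "cnj (y $ _)"])
qed

section \<open>The minimum over the sphere is a minimum over the ball\<close>

lemma eigenvectors_shift:
  fixes x :: "complex^'n"
  assumes "M *v x = \<mu> *s x"
  shows "(M + mat s) *v x = (\<mu> + s) *s x"
  using assms by (simp add: matrix_vector_mult_add_rdistrib mat_mult_vec vector_sadd_rdistrib)

lemma rmin_le_on_sphere:
  assumes E: "entries_in K E" "norm E = 1"
    and u: "(A + \<epsilon> *\<^sub>R E) *v u = \<mu> *s u" and v: "cadj (A + \<epsilon> *\<^sub>R E) *v v = cnj \<mu> *s v"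
  shows "rmin K A \<epsilon> * (norm u * norm v) \<le> cmod (hprod v u)"
proof (cases "u = 0 \<or> v = 0")
  case True
  then show ?thesis by auto
next
  case False
  define h where "h = hprod v u"
  \<comment> \<open>The phase \<open>c\<close> turns \<open>v\<^sup>H u\<close> into a nonnegative real.\<close>
  define c where "c = (if h = 0 then 1 else cnj h / of_real (cmod h))"
  have c: "cmod c = 1" "c * h = of_real (cmod h)"
    by (auto simp: c_def norm_divide complex_norm_square[symmetric] power2_eq_square
        mult.commute[of "cnj h"])
  define x where "x = (c / of_real (norm u)) *s u"
  define y where "y = (1 / of_real (norm v)) *s v"
  have "unit_eigenvectors (A + \<epsilon> *\<^sub>R E) \<mu> x y"
    using u v False c(1) unfolding unit_eigenvectors_def left_eigenvector_iff_cadj x_def y_def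
    by (auto simp: vector_scalar_commute norm_smult norm_divide mult_ac vector_smult_assoc)
  moreover have "hprod y x = of_real (cmod h / (norm u * norm v))"
  proof -
    have "hprod y x = c * h / of_real (norm u * norm v)"
      by (simp add: x_def y_def h_def)
    then show ?thesis by (simp add: c(2))
  qed
  ultimately have "cmod h / (norm u * norm v) \<in> eigenvector_products K A \<epsilon>"
    unfolding eigenvector_products_def using E by auto
  then have "rmin K A \<epsilon> \<le> cmod h / (norm u * norm v)"
    unfolding rmin_def
    by (rule cInf_lower) (auto simp: bdd_below_def eigenvector_products_def)
  then show ?thesis
    using False by (simp add: h_def field_simps)
qed

text \<open>
  Adding a real multiple of the identity changes no eigenvector and keeps the entries in \<open>K\<close>.
  A matrix in the ball of radius \<open>\<epsilon>\<close> about \<open>A\<close> can be moved by such a shift until it reaches the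
  sphere, where the definition of \<^const>\<open>rmin\<close> applies.
\<close>

lemma rmin_le_on_ball:
  fixes A M :: "complex^'n^'n"
  assumes K: "K = UNIV \<or> K = \<real>" and "0 < \<epsilon>"
    and M: "entries_in K (M - A)" "norm (M - A) \<le> \<epsilon>"
    and u: "M *v u = \<mu> *s u" and v: "cadj M *v v = cnj \<mu> *s v"
  shows "rmin K A \<epsilon> * (norm u * norm v) \<le> cmod (hprod v u)"
proof -
  define J :: "complex^'n^'n" where "J = mat 1"
  define n where "n = norm J"
  have "J \<noteq> 0" by (auto simp: J_def mat_def vec_eq_iff)
  then have "n > 0" by (simp add: n_def)
  have "norm (M - A + (2 * \<epsilon> / n) *\<^sub>R J) \<ge> norm ((2 * \<epsilon> / n) *\<^sub>R J) - norm (M - A)"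
    using norm_diff_ineq[of "(2 * \<epsilon> / n) *\<^sub>R J" "M - A"] by (simp add: add.commute)
  moreover have "norm ((2 * \<epsilon> / n) *\<^sub>R J) = 2 * \<epsilon>"
    using \<open>n > 0\<close> \<open>0 < \<epsilon>\<close> by (simp add: n_def)
  ultimately have "\<epsilon> \<le> norm (M - A + (2 * \<epsilon> / n) *\<^sub>R J)"
    using M(2) by linarith
  moreover have "0 \<le> 2 * \<epsilon> / n" using \<open>n > 0\<close> \<open>0 < \<epsilon>\<close> by simp
  moreover have "norm (M - A + 0 *\<^sub>R J) \<le> \<epsilon>" using M(2) by simp
  \<comment> \<open>The shift \<open>s = 0\<close> stays in the ball and \<open>s = 2\<epsilon>/\<parallel>I\<parallel>\<close> moves by \<open>2\<epsilon>\<close>,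
    a diameter of the ball.\<close>
  ultimately obtain s where s: "norm (M - A + s *\<^sub>R J) = \<epsilon>"
    using IVT'[of "\<lambda>s. norm (M - A + s *\<^sub>R J)" 0 \<epsilon> "2 * \<epsilon> / n"]
    by (force intro!: continuous_intros)
  define E where "E = (1 / \<epsilon>) *\<^sub>R (M - A + s *\<^sub>R J)"
  have sJ: "s *\<^sub>R J = mat (of_real s)"
    by (simp add: J_def mat_def vec_eq_iff scaleR_conv_of_real[where 'a = complex])
  have AE: "A + \<epsilon> *\<^sub>R E = M + mat (of_real s)"
    using \<open>0 < \<epsilon>\<close> by (simp add: E_def sJ)
  have "entries_in K E"
    using K M(1)
    by (auto simp: entries_in_def E_def sJ mat_def scaleR_conv_of_real[where 'a = complex])
  moreover have "norm E = 1" using s \<open>0 < \<epsilon>\<close> by (simp add: E_def)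
  moreover have "(A + \<epsilon> *\<^sub>R E) *v u = (\<mu> + of_real s) *s u"
    using eigenvectors_shift[OF u] by (simp add: AE)
  moreover have "cadj (A + \<epsilon> *\<^sub>R E) *v v = cnj (\<mu> + of_real s) *s v"
    using eigenvectors_shift[OF v, of "of_real s"]
    by (simp add: AE linear_add[OF linear_cadj] cadj_mat)
  ultimately show ?thesis
    by (rule rmin_le_on_sphere)
qed

section \<open>Simple eigenvalues and the group inverse\<close>

text \<open>
  The last assumption says that \<open>\<mu>\<close> is geometrically simple: the eigenspace meets the
  complement \<open>y\<^sup>\<bottom>\<close> of \<open>x\<close> trivially.  Together with \<open>y\<^sup>H x \<noteq> 0\<close> this makes
  \<open>\<mu>\<close> algebraically simple.
\<close>

locale simple_eigentriple =
  fixes M :: "complex^'n^'n" and \<mu> :: complex and x y :: "complex^'n" and r :: real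
  assumes right: "M *v x = \<mu> *s x" and left: "cadj M *v y = cnj \<mu> *s y"
    and norm_x: "norm x = 1" and norm_y: "norm y = 1"
    and hprod_yx: "hprod y x = of_real r" and r_pos: "0 < r"
    and simple: "M *v w = \<mu> *s w \<Longrightarrow> hprod y w = 0 \<Longrightarrow> w = 0"
begin

definition N where "N = M - mat \<mu>"
definition \<Gamma> where "\<Gamma> = group_inverse N"

lemma N_mult: "N *v w = M *v w - \<mu> *s w"
  by (simp add: N_def matrix_vector_mult_diff_rdistrib mat_mult_vec)

lemma hprod_N: "hprod y (N *v w) = 0"
  by (simp add: N_mult hprod_simps hprod_cadj[symmetric] left)

text \<open>
  With \<open>P = x y\<^sup>H / r\<close> the spectral projector of \<open>M\<close> at \<open>\<mu>\<close>, the matrix \<open>N + P\<close> is injective, hence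
  invertible, and \<open>(N + P)\<inverse> - P\<close> is the group inverse: it inverts \<open>N\<close> on \<open>y\<^sup>\<bottom>\<close> and vanishes
  at \<open>x\<close>, so that \<open>N \<Gamma> = \<Gamma> N = I - P\<close>.
\<close>

lemma is_group_inverse_\<Gamma>:
  shows "is_group_inverse N \<Gamma>"
    and "N *v (\<Gamma> *v w) = w - (hprod y w / r) *s x"
    and "\<Gamma> *v x = 0"
proof -
  define P :: "complex^'n^'n" where "P = (\<chi> i j. x $ i * cnj (y $ j) / of_real r)"
  have P: "P *v w = (hprod y w / r) *s x" for w
    by (simp add: P_def vec_eq_iff matrix_vector_mult_def hprod_def sum_divide_distrib
        sum_distrib_left sum_distrib_right mult_ac)
  have Nx: "N *v x = 0" by (simp add: N_mult right)
  have "w = 0" if "(N + P) *v w = 0" for w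
  proof -
    have *: "N *v w + P *v w = 0"
      using that by (simp add: matrix_vector_mult_add_rdistrib)
    then have "hprod y (N *v w + P *v w) = 0" by (simp add: hprod_simps)
    then have "hprod y w = 0"
      using r_pos by (simp add: bounded_bilinear.add_right[OF bounded_bilinear_hprod] hprod_N P hprod_yx)
    with * show "w = 0" by (intro simple) (simp_all add: P N_mult)
  qed
  then obtain B where B: "B ** (N + P) = mat 1"
    using matrix_left_invertible_ker[of "N + P"] by auto
  then have B': "(N + P) ** B = mat 1" by (simp add: matrix_left_right_inverse)
  have rdistrib: "(D + F) ** C = D ** C + F ** C" and sub: "C ** (D - F) = C ** D - C ** F"
    "(D - F) ** C = D ** C - F ** C" for C D F :: "complex^'n^'n"
    by (simp_all add: matrix_eq matrix_vector_mul_assoc[symmetric] matrix_vector_mult_add_rdistrib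
        matrix_vector_mult_diff_rdistrib matrix_vector_mult_diff_distrib)
  have NP: "N ** P = 0" and PN: "P ** N = 0" and PP: "P ** P = P"
    using r_pos
    by (simp_all add: matrix_eq matrix_vector_mul_assoc[symmetric] P vector_scalar_commute Nx
        hprod_N hprod_yx)
  have BP: "B ** P = P"
    using arg_cong[OF B, of "\<lambda>Z. Z ** P"]
    by (simp add: matrix_mul_assoc[symmetric] rdistrib NP PP)
  have PB: "P ** B = P"
    using arg_cong[OF B', of "\<lambda>Z. P ** Z"]
    by (simp add: matrix_mul_assoc matrix_add_ldistrib PN PP)
  define H where "H = B - P"
  have NB: "N ** B = mat 1 - P" and BN: "B ** N = mat 1 - P"
    using B B' BP PB by (simp_all add: matrix_add_ldistrib rdistrib algebra_simps)
  have NH: "N ** H = mat 1 - P" and HN: "H ** N = mat 1 - P"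
    by (simp_all add: H_def sub NB BN NP PN)
  have HP: "H ** P = 0" by (simp add: H_def sub BP PP)
  have PH: "P ** H = 0" by (simp add: H_def sub PB PP)
  have H: "is_group_inverse N H"
    unfolding is_group_inverse_def by (simp add: NH HN sub PH PN)
  have "\<Gamma> = H"
    unfolding \<Gamma>_def group_inverse_def
    using H is_group_inverse_unique by (intro the_equality) blast+
  then show "is_group_inverse N \<Gamma>" "N *v (\<Gamma> *v w) = w - (hprod y w / r) *s x"
    using H by (simp_all add: matrix_vector_mul_assoc NH matrix_vector_mult_diff_rdistrib P)
  have "H *v (P *v x) = 0" by (simp add: matrix_vector_mul_assoc HP)
  then show "\<Gamma> *v x = 0"
    using r_pos \<open>\<Gamma> = H\<close> by (simp add: P hprod_yx)
qed

lemma \<Gamma>_N: "\<Gamma> *v (N *v w) = w - (hprod y w / r) *s x"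
  using is_group_inverse_\<Gamma>(1,2)
  by (simp add: is_group_inverse_def matrix_vector_mul_assoc)

text \<open>
  Simplicity passes to the adjoint: \<open>w\<close> in the kernel of \<open>N\<^sup>H\<close> is orthogonal to the range of \<open>N\<close>,
  which contains \<open>w - (y\<^sup>H w / r) x\<close>; if also \<open>x\<^sup>H w = 0\<close>, then \<open>w\<^sup>H w = 0\<close>.
\<close>

lemma adjoint: "simple_eigentriple (cadj M) (cnj \<mu>) y x r"
proof
  show "hprod x y = of_real r"
    using cnj_hprod[of y x] by (simp add: hprod_yx)
  fix w assume "cadj M *v w = cnj \<mu> *s w" and 0: "hprod x w = 0"
  then have "hprod w (N *v v) = 0" for v
    by (simp add: N_mult hprod_simps hprod_cadj[symmetric])
  from this[of "\<Gamma> *v w"] have "hprod w w - hprod y w / r * hprod w x = 0"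
    by (simp add: is_group_inverse_\<Gamma> hprod_simps)
  moreover have "hprod w x = 0" using 0 cnj_hprod[of x w] by simp
  ultimately show "w = 0" by (simp add: hprod_self)
qed (simp_all add: right left norm_x norm_y r_pos)

lemma adjoint_N: "simple_eigentriple.N (cadj M) (cnj \<mu>) = cadj N"
proof -
  interpret adj: simple_eigentriple "cadj M" "cnj \<mu>" y x r by (rule adjoint)
  show ?thesis
    by (simp add: adj.N_def N_def linear_diff[OF linear_cadj] cadj_mat)
qed

lemma adjoint_\<Gamma>: "simple_eigentriple.\<Gamma> (cadj M) (cnj \<mu>) = cadj \<Gamma>"
proof -
  interpret adj: simple_eigentriple "cadj M" "cnj \<mu>" y x r by (rule adjoint)
  have "is_group_inverse adj.N (cadj \<Gamma>)"
    using is_group_inverse_\<Gamma>(1)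
    unfolding is_group_inverse_def adjoint_N by (metis cadj_matrix_mult matrix_mul_assoc)
  then show ?thesis
    using adj.is_group_inverse_\<Gamma>(1) is_group_inverse_unique by blast
qed

section \<open>First variation of the eigenvector product\<close>

text \<open>
  The hypothesis is the eigenvector equation differentiated once, with \<open>w\<close> the derivative of the
  eigenvector, \<open>H\<close> that of the matrix and \<open>\<nu>\<close> that of the eigenvalue.  Multiplication by \<open>\<Gamma>\<close> removes
  \<open>\<nu>\<close> and determines \<open>w\<close> up to a multiple of \<open>x\<close>; pairing with \<open>x\<close> determines that multiple.
\<close>

lemma right_variation:
  assumes "N *v w + H *v x = \<nu> *s x"
  shows "hprod y w = r * (hprod x w + hprod x (\<Gamma> *v (H *v x)))"
proof -
  have "\<Gamma> *v (N *v w + H *v x) = 0"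
    unfolding assms by (simp add: vector_scalar_commute is_group_inverse_\<Gamma>)
  then have "w - (hprod y w / r) *s x + \<Gamma> *v (H *v x) = 0"
    by (simp add: matrix_vector_right_distrib \<Gamma>_N)
  then have "hprod x (w - (hprod y w / r) *s x + \<Gamma> *v (H *v x)) = 0"
    by (simp add: hprod_simps)
  then show ?thesis
    using r_pos by (simp add: hprod_simps hprod_self norm_x field_simps)
qed

text \<open>
  The derivative of \<open>log (\<bar>y\<^sup>H x\<bar> / (\<parallel>x\<parallel> \<parallel>y\<parallel>))\<close> when the matrix moves in direction \<open>H\<close>.
\<close>

definition sensitivity :: "complex^'n^'n \<Rightarrow> real" where
  "sensitivity H = Re (hprod x (\<Gamma> *v (H *v x)) + hprod y (H *v (\<Gamma> *v y)))"

lemma linear_sensitivity: "linear sensitivity"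
  by (simp add: linear_iff sensitivity_def matrix_vector_mult_add_rdistrib
      matrix_vector_right_distrib hprod_simps scaleR_mult_vec
      bounded_bilinear.scaleR_right[OF bounded_bilinear_mult_vec] algebra_simps)

lemma eigenvector_product_variation:
  assumes u: "N *v u + H *v x = \<nu> *s x"
    and v: "cadj N *v v + cadj H *v y = \<kappa> *s y"
  shows "Re (hprod y u + hprod v x) = r * (x \<bullet> u + y \<bullet> v + sensitivity H)"
proof -
  interpret adj: simple_eigentriple "cadj M" "cnj \<mu>" y x r by (rule adjoint)
  have "hprod x v = r * (hprod y v + hprod y (cadj \<Gamma> *v (cadj H *v y)))"
    using adj.right_variation[of v "cadj H" \<kappa>] v by (simp add: adjoint_N adjoint_\<Gamma>)
  then have "Re (hprod x v) = r * (y \<bullet> v + Re (hprod (H *v (\<Gamma> *v y)) y))"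
    by (simp add: hprod_cadj_right Re_hprod)
  moreover have "Re (hprod y u) = r * (x \<bullet> u + Re (hprod x (\<Gamma> *v (H *v x))))"
    using right_variation[OF u] by (simp add: Re_hprod)
  moreover have "Re (hprod v x) = Re (hprod x v)"
    "Re (hprod (H *v (\<Gamma> *v y)) y) = Re (hprod y (H *v (\<Gamma> *v y)))"
    by (simp_all add: Re_hprod inner_commute)
  ultimately show ?thesis
    by (simp add: sensitivity_def algebra_simps)
qed

end

lemma differentiated_eigenvector_equation:
  fixes x :: "real \<Rightarrow> complex^'n"
  assumes M: "(M has_vector_derivative M') (at t within S)"
    and x: "(x has_vector_derivative x') (at t within S)"
    and l: "(l has_vector_derivative l') (at t within S)"
    and eq: "\<And>s. s \<in> S \<Longrightarrow> M s *v x s = l s *s x s"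
    and t: "t \<in> S" "at t within S \<noteq> bot"
  shows "(M t - mat (l t)) *v x' + M' *v x t = l' *s x t"
proof -
  have "((\<lambda>s. M s *v x s) has_vector_derivative M t *v x' + M' *v x t) (at t within S)"
    by (rule bounded_bilinear.has_vector_derivative[OF bounded_bilinear_mult_vec M x])
  moreover have "((\<lambda>s. l s *s x s) has_vector_derivative l t *s x' + l' *s x t) (at t within S)"
    by (rule bounded_bilinear.has_vector_derivative[OF bounded_bilinear_smult l x])
  then have "((\<lambda>s. M s *v x s) has_vector_derivative l t *s x' + l' *s x t) (at t within S)"
    by (rule has_vector_derivative_transform[rotated 2]) (use eq t in auto)
  ultimately have "M t *v x' + M' *v x t = l t *s x' + l' *s x t"
    by (rule vector_derivative_unique_within[OF t(2)])
  then show ?thesis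
    by (simp add: matrix_vector_mult_diff_rdistrib mat_mult_vec algebra_simps)
qed

context simple_eigentriple
begin

text \<open>
  The inverse function theorem is applied to
  \<open>(t, v, \<nu>) \<mapsto> (t, (M + t H) v - \<nu> v, y\<^sup>H v)\<close> at \<open>(0, x, \<mu>)\<close>.  The last component fixes the
  scaling of \<open>v\<close>; simplicity of \<open>\<mu>\<close> makes the derivative injective there.  The perturbed eigenpair
  is the inverse image of \<open>(t, 0, r)\<close>.
\<close>

lemma perturbed_right_eigenvector:
  obtains \<delta> v \<nu> v' \<nu>' where "0 < \<delta>" and "v 0 = x" and "\<nu> 0 = \<mu>"
    and "\<And>t. \<bar>t\<bar> < \<delta> \<Longrightarrow> (M + t *\<^sub>R H) *v v t = \<nu> t *s v t"
    and "(v has_vector_derivative v') (at 0)" and "(\<nu> has_vector_derivative \<nu>') (at 0)"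
proof -
  define f where "f = (\<lambda>p::real \<times> (complex^'n) \<times> complex.
     (fst p, (M + fst p *\<^sub>R H) *v fst (snd p) - snd (snd p) *s fst (snd p), hprod y (fst (snd p))))"
  define f' where "f' = (\<lambda>p q::real \<times> (complex^'n) \<times> complex.
     (fst q, (fst q *\<^sub>R H) *v fst (snd p) + (M + fst p *\<^sub>R H) *v fst (snd q)
        - snd (snd q) *s fst (snd p) - snd (snd p) *s fst (snd q), hprod y (fst (snd q))))"
  have cont_intros: "continuous_on S (\<lambda>p. g p *v h p)" "continuous_on S (\<lambda>p. k p *s h p)"
    if "continuous_on S g" "continuous_on S h" "continuous_on S k"
    for S :: "(real \<times> (complex^'n) \<times> complex) set" and g :: "_ \<Rightarrow> complex^'n^'n" and h k
    using that by (auto intro: bounded_bilinear.continuous_on[OF bounded_bilinear_mult_vec]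
        bounded_bilinear.continuous_on[OF bounded_bilinear_smult])
  have der: "(f has_derivative f' p) (at p)" for p
    unfolding f_def f'_def
    by (auto intro!: derivative_eq_intros
         bounded_bilinear.FDERIV[OF bounded_bilinear_mult_vec]
         bounded_bilinear.FDERIV[OF bounded_bilinear_smult]
         bounded_linear.has_derivative[OF bounded_bilinear.bounded_linear_right[OF bounded_bilinear_hprod]]
         simp: fun_eq_iff algebra_simps)
  then have bl: "bounded_linear (f' p)" for p by (rule has_derivative_bounded_linear)
  define F where "F = (\<lambda>p. Blinfun (f' p))"
  have F: "blinfun_apply (F p) = f' p" for p
    by (simp add: F_def bounded_linear_Blinfun_apply bl)
  define p0 where "p0 = (0::real, x, \<mu>)"
  have "inj (f' p0)"
  proof (rule linear_injective_0[THEN iffD2])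
    show "linear (f' p0)" using bl by (rule bounded_linear.linear)
    show "\<forall>q. f' p0 q = 0 \<longrightarrow> q = 0"
    proof (intro allI impI)
      fix q assume q: "f' p0 q = 0"
      obtain \<tau> w \<kappa> where [simp]: "q = (\<tau>, w, \<kappa>)" by (cases q)
      have eq: "\<tau> = 0" "N *v w = \<kappa> *s x" "hprod y w = 0"
        using q by (auto simp: f'_def p0_def zero_prod_def N_mult algebra_simps)
      have "\<kappa> * r = 0" using hprod_N[of w] by (simp add: eq hprod_yx)
      then have "\<kappa> = 0" using r_pos by simp
      then have "w = 0" using eq by (intro simple) (simp_all add: N_mult)
      with eq \<open>\<kappa> = 0\<close> show "q = 0" by (simp add: zero_prod_def)
    qed
  qed
  then obtain h where h: "linear h" "h \<circ> f' p0 = id"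
    using linear_injective_left_inverse[of "f' p0"] bl bounded_linear.linear by blast
  have inv: "Blinfun h o\<^sub>L F p0 = id_blinfun"
    using h by (intro blinfun_eqI)
      (simp add: bounded_linear_Blinfun_apply linear_conv_bounded_linear F pointfree_idE)
  have contF: "continuous_on UNIV F"
    by (rule continuous_on_blinfun_componentwise)
      (auto simp: F f'_def intro!: continuous_intros cont_intros)
  obtain U V g g' where "p0 \<in> U" and V: "open V" "f p0 \<in> V" and hom: "homeomorphism U V f g"
    and g: "\<And>p. p \<in> V \<Longrightarrow> (g has_derivative g' p) (at p)"
    using inverse_function_theorem[of UNIV f F p0 "Blinfun h"] der contF inv
    unfolding F by (metis UNIV_I open_UNIV)
  have fp0: "f p0 = (0, 0, of_real r)"
    by (simp add: f_def p0_def right hprod_yx)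
  have "continuous (at 0) (\<lambda>t. (t, 0, of_real r) :: real \<times> (complex^'n) \<times> complex)"
    by (intro continuous_intros)
  then have "\<forall>\<^sub>F t in at 0. (t, 0, of_real r) \<in> V"
    using V fp0 by (auto simp: continuous_within intro: topological_tendstoD)
  then obtain \<delta> where "0 < \<delta>" and "\<And>t. t \<noteq> 0 \<Longrightarrow> \<bar>t\<bar> < \<delta> \<Longrightarrow> (t, 0, of_real r) \<in> V"
    by (auto simp: eventually_at)
  with V fp0 have \<delta>: "\<bar>t\<bar> < \<delta> \<Longrightarrow> (t, 0, of_real r) \<in> V" for t by (cases "t = 0") auto
  define c where "c = (\<lambda>t. g (t, 0, of_real r))"
  have fc: "f (c t) = (t, 0, of_real r)" if "\<bar>t\<bar> < \<delta>" for t
    using hom \<delta>[OF that] by (simp add: c_def homeomorphism_apply2)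
  have eq: "(M + t *\<^sub>R H) *v fst (snd (c t)) = snd (snd (c t)) *s fst (snd (c t))"
    if "\<bar>t\<bar> < \<delta>" for t
    using fc[OF that] by (auto simp: f_def)
  have c0: "c 0 = p0"
    using hom \<open>p0 \<in> U\<close> by (simp add: c_def fp0[symmetric] homeomorphism_apply1)
  have "((\<lambda>t. (t, 0, of_real r)) has_vector_derivative (1, 0, 0)) (at 0)"
    by (auto intro!: derivative_eq_intros has_vector_derivative_Pair simp: zero_prod_def)
  then have "(c has_vector_derivative g' (f p0) (1, 0, 0)) (at 0)"
    unfolding c_def 
    using vector_derivative_diff_chain_within[of "\<lambda>t. (t, 0, of_real r)" "(1,0,0)" 0 UNIV g "g' (f p0)"] 
      g[OF V(2)] by (simp add: o_def fp0 has_derivative_at_withinI)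
  then have "((\<lambda>t. fst (snd (c t))) has_vector_derivative fst (snd (g' (f p0) (1, 0, 0)))) (at 0)"
    "((\<lambda>t. snd (snd (c t))) has_vector_derivative snd (snd (g' (f p0) (1, 0, 0)))) (at 0)"
    using bounded_linear.has_vector_derivative[OF bounded_linear_compose[OF bounded_linear_fst bounded_linear_snd]]
      bounded_linear.has_vector_derivative[OF bounded_linear_compose[OF bounded_linear_snd bounded_linear_snd]]
    by blast+
  then show ?thesis
    using that[of \<delta> "\<lambda>t. fst (snd (c t))" "\<lambda>t. snd (snd (c t))"] \<open>0 < \<delta>\<close> eq c0
    by (simp add: p0_def)
qed

text \<open>
  Along the line \<open>M + t H\<close> the normalised product of the perturbed eigenvectors starts at \<open>r\<close> and
  does not fall below it for small \<open>t > 0\<close>, so its right derivative is nonnegative.  The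
  comparison is made between squares, which are differentiable without exception.
\<close>

lemma sensitivity_nonneg:
  assumes "0 < d"
    and bound: "\<And>t \<nu> u v. 0 < t \<Longrightarrow> t < d \<Longrightarrow> (M + t *\<^sub>R H) *v u = \<nu> *s u \<Longrightarrow>
      cadj (M + t *\<^sub>R H) *v v = cnj \<nu> *s v \<Longrightarrow> r * (norm u * norm v) \<le> cmod (hprod v u)"
  shows "0 \<le> sensitivity H"
proof -
  interpret adj: simple_eigentriple "cadj M" "cnj \<mu>" y x r by (rule adjoint)
  obtain \<delta>1 u \<nu> u' \<nu>' where "0 < \<delta>1" and u0: "u 0 = x" "\<nu> 0 = \<mu>"
    and u: "\<And>t. \<bar>t\<bar> < \<delta>1 \<Longrightarrow> (M + t *\<^sub>R H) *v u t = \<nu> t *s u t"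
    and u': "(u has_vector_derivative u') (at 0)" "(\<nu> has_vector_derivative \<nu>') (at 0)"
    using perturbed_right_eigenvector[of H] by metis
  obtain \<delta>2 v \<kappa> v' \<kappa>' where "0 < \<delta>2" and v0: "v 0 = y" "\<kappa> 0 = cnj \<mu>"
    and v_adj: "\<And>t. \<bar>t\<bar> < \<delta>2 \<Longrightarrow> (cadj M + t *\<^sub>R cadj H) *v v t = \<kappa> t *s v t"
    and v': "(v has_vector_derivative v') (at 0)" "(\<kappa> has_vector_derivative \<kappa>') (at 0)"
    using adj.perturbed_right_eigenvector[of "cadj H"] by metis
  have v: "cadj (M + t *\<^sub>R H) *v v t = \<kappa> t *s v t" if "\<bar>t\<bar> < \<delta>2" for t
    using v_adj[OF that] by (simp add: linear_add[OF linear_cadj] linear_cmul[OF linear_cadj])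
  define h where "h = (\<lambda>t. hprod (v t) (u t))"
  define h' where "h' = hprod y u' + hprod v' x"
  have h0: "h 0 = of_real r" by (simp add: h_def u0 v0 hprod_yx)
  have h': "(h has_vector_derivative h') (at 0)"
    using bounded_bilinear.has_vector_derivative[OF bounded_bilinear_hprod v'(1) u'(1)]
    by (simp add: h_def h'_def u0 v0)
  have Re_h': "Re h' = r * (x \<bullet> u' + y \<bullet> v' + sensitivity H)"
  proof -
    have lin: "((\<lambda>t. B + t *\<^sub>R C) has_vector_derivative C) (at 0 within S)"
      for B C :: "complex^'n^'n" and S
      unfolding has_vector_derivative_def by (auto intro!: derivative_eq_intros)
    have at0: "at 0 within {-\<delta><..<\<delta>} = at (0::real)" if "0 < \<delta>" for \<delta>
      using that by (intro at_within_open) auto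
    have "(M + 0 *\<^sub>R H - mat (\<nu> 0)) *v u' + H *v u 0 = \<nu>' *s u 0"
      by (rule differentiated_eigenvector_equation[of "\<lambda>t. M + t *\<^sub>R H" _ _ "{-\<delta>1<..<\<delta>1}"])
        (use at0 lin u u' \<open>0 < \<delta>1\<close> in \<open>auto simp: abs_less_iff\<close>)
    then have "N *v u' + H *v x = \<nu>' *s x"
      by (simp add: u0 N_def)
    moreover have "(cadj M + 0 *\<^sub>R cadj H - mat (\<kappa> 0)) *v v' + cadj H *v v 0 = \<kappa>' *s v 0"
      by (rule differentiated_eigenvector_equation[of "\<lambda>t. cadj M + t *\<^sub>R cadj H" _ _ "{-\<delta>2<..<\<delta>2}"])
        (use at0 lin v_adj v' \<open>0 < \<delta>2\<close> in \<open>auto simp: abs_less_iff\<close>)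
    then have "cadj N *v v' + cadj H *v y = \<kappa>' *s y"
      by (simp add: v0 adj.N_def[symmetric] adjoint_N)
    ultimately show ?thesis
      unfolding h'_def by (rule eigenvector_product_variation)
  qed
  define \<phi> where "\<phi> = (\<lambda>t. h t \<bullet> h t - r\<^sup>2 * ((u t \<bullet> u t) * (v t \<bullet> v t)))"
  have inner_deriv: "((\<lambda>t. f t \<bullet> f t) has_real_derivative 2 * (f 0 \<bullet> f')) (at 0)"
    if "(f has_vector_derivative f') (at 0)" for f :: "real \<Rightarrow> 'b::real_inner" and f'
    using bounded_bilinear.has_vector_derivative[OF bounded_bilinear_inner that that]
    by (simp add: has_real_derivative_iff_has_vector_derivative inner_commute)
  have "(\<phi> has_real_derivative 2 * (h 0 \<bullet> h') -
      r\<^sup>2 * (2 * (u 0 \<bullet> u') * (v 0 \<bullet> v 0) + 2 * (v 0 \<bullet> v') * (u 0 \<bullet> u 0))) (at 0)"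
    unfolding \<phi>_def by (intro DERIV_diff DERIV_cmult DERIV_mult inner_deriv h' u' v')
  moreover have "2 * (h 0 \<bullet> h') -
      r\<^sup>2 * (2 * (u 0 \<bullet> u') * (v 0 \<bullet> v 0) + 2 * (v 0 \<bullet> v') * (u 0 \<bullet> u 0)) = 2 * r\<^sup>2 * sensitivity H"
    using norm_x norm_y
    by (simp add: u0 v0 h0 inner_complex_def Re_h' dot_square_norm power2_eq_square algebra_simps)
  ultimately have \<phi>': "(\<phi> has_real_derivative 2 * r\<^sup>2 * sensitivity H) (at 0)" by simp
  have "isCont h 0"
    using h' by (rule has_vector_derivative_continuous)
  then have "\<forall>\<^sub>F t in at 0. h t \<noteq> 0"
    using h0 r_pos by (intro tendsto_imp_eventually_ne[of h "h 0"]) (auto simp: isCont_def)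
  then obtain \<delta>3 where "0 < \<delta>3" and h_nz: "\<And>t. t \<noteq> 0 \<Longrightarrow> \<bar>t\<bar> < \<delta>3 \<Longrightarrow> h t \<noteq> 0"
    by (auto simp: eventually_at)
  show ?thesis
  proof (rule ccontr)
    assume "\<not> 0 \<le> sensitivity H"
    then have "2 * r\<^sup>2 * sensitivity H < 0"
      using r_pos by (simp add: mult_pos_neg)
    then obtain \<delta>4 where "0 < \<delta>4" and dec: "\<And>t. 0 < t \<Longrightarrow> t < \<delta>4 \<Longrightarrow> \<phi> t < \<phi> 0"
      using DERIV_neg_dec_right[OF \<phi>'] by auto
    define t where "t = min (min \<delta>1 \<delta>2) (min \<delta>3 (min \<delta>4 d)) / 2"
    have t: "0 < t" "t < \<delta>1" "t < \<delta>2" "t < \<delta>3" "t < \<delta>4" "t < d"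
      using \<open>0 < \<delta>1\<close> \<open>0 < \<delta>2\<close> \<open>0 < \<delta>3\<close> \<open>0 < \<delta>4\<close> \<open>0 < d\<close> by (auto simp: t_def min_def)
    \<comment> \<open>The right and left perturbations are constructed independently; since the product of the
      vectors does not vanish, they belong to the same eigenvalue.\<close>
    have "\<nu> t * h t = hprod (v t) ((M + t *\<^sub>R H) *v u t)"
      using t by (simp add: u h_def)
    also have "\<dots> = cnj (\<kappa> t) * h t"
      using t by (simp add: hprod_cadj[symmetric] v h_def)
    finally have "\<kappa> t = cnj (\<nu> t)"
      using h_nz[of t] t by auto
    then have "r * (norm (u t) * norm (v t)) \<le> cmod (h t)"
      unfolding h_def using u[of t] v[of t] t by (intro bound) auto
    then have "(r * (norm (u t) * norm (v t)))\<^sup>2 \<le> (cmod (h t))\<^sup>2"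
      using r_pos by (intro power_mono) auto
    then have "0 \<le> \<phi> t"
      by (simp add: \<phi>_def dot_square_norm power_mult_distrib)
    moreover have "\<phi> 0 = 0"
      using norm_x norm_y by (simp add: \<phi>_def h0 u0 v0 dot_square_norm)
    ultimately show False using dec[of t] t by simp
  qed
qed

end

section \<open>Stationarity of a minimizer along tangent directions\<close>

lemma entries_in_combination:
  assumes "K = UNIV \<or> K = \<real>" "entries_in K B" "entries_in K C"
  shows "entries_in K (s *\<^sub>R B + t *\<^sub>R C)"
  using assms by (auto simp: entries_in_def scaleR_conv_of_real[where 'a = complex])

text \<open>
  A direction \<open>H\<close> with \<open>\<langle>E, H\<rangle> < 0\<close> enters the ball of radius \<open>\<epsilon>\<close> at \<open>A + \<epsilon> E\<close>, and the minimum over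
  the sphere is also a lower bound on the ball.
\<close>

lemma sensitivity_nonneg_inward:
  fixes A :: "complex^'n^'n"
  assumes K: "K = UNIV \<or> K = \<real>" and "0 < \<epsilon>"
    and E: "entries_in K E" "norm E = 1" and H: "entries_in K H" "E \<bullet> H < 0"
    and triple: "simple_eigentriple (A + \<epsilon> *\<^sub>R E) \<mu> x y (rmin K A \<epsilon>)"
  shows "0 \<le> simple_eigentriple.sensitivity (A + \<epsilon> *\<^sub>R E) \<mu> x y H"
proof -
  have "H \<noteq> 0" using H(2) by auto
  \<comment> \<open>The other parameter at which the line meets the sphere, as
    \<open>\<parallel>\<epsilon> E + t H\<parallel>\<^sup>2 = \<epsilon>\<^sup>2 + t (2\<epsilon> \<langle>E, H\<rangle> + t \<parallel>H\<parallel>\<^sup>2)\<close>.\<close>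
  define d where "d = - 2 * \<epsilon> * (E \<bullet> H) / (H \<bullet> H)"
  have "0 < d"
    using \<open>H \<noteq> 0\<close> \<open>0 < \<epsilon>\<close> H(2) by (auto simp: d_def intro!: divide_neg_pos mult_pos_neg)
  moreover have "rmin K A \<epsilon> * (norm u * norm v) \<le> cmod (hprod v u)"
    if t: "0 < t" "t < d" and u: "(A + \<epsilon> *\<^sub>R E + t *\<^sub>R H) *v u = \<nu> *s u"
      and v: "cadj (A + \<epsilon> *\<^sub>R E + t *\<^sub>R H) *v v = cnj \<nu> *s v" for t \<nu> u v
  proof (rule rmin_le_on_ball[OF K \<open>0 < \<epsilon>\<close> _ _ u v])
    have eq: "A + \<epsilon> *\<^sub>R E + t *\<^sub>R H - A = \<epsilon> *\<^sub>R E + t *\<^sub>R H" by simp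
    show "entries_in K (A + \<epsilon> *\<^sub>R E + t *\<^sub>R H - A)"
      unfolding eq by (rule entries_in_combination[OF K E(1) H(1)])
    have "(norm (\<epsilon> *\<^sub>R E + t *\<^sub>R H))\<^sup>2 = \<epsilon>\<^sup>2 + t * (2 * \<epsilon> * (E \<bullet> H) + t * (H \<bullet> H))"
      unfolding power2_norm_eq_inner using E(2)
      by (simp add: inner_simps inner_commute dot_square_norm[of E] power2_eq_square algebra_simps)
    moreover have "2 * \<epsilon> * (E \<bullet> H) + t * (H \<bullet> H) \<le> 0"
      using t(2) \<open>H \<noteq> 0\<close> by (simp add: d_def field_simps)
    then have "t * (2 * \<epsilon> * (E \<bullet> H) + t * (H \<bullet> H)) \<le> 0"
      using t(1) by (simp add: mult_nonneg_nonpos)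
    ultimately have "(norm (\<epsilon> *\<^sub>R E + t *\<^sub>R H))\<^sup>2 \<le> \<epsilon>\<^sup>2" by simp
    then show "norm (A + \<epsilon> *\<^sub>R E + t *\<^sub>R H - A) \<le> \<epsilon>"
      unfolding eq using \<open>0 < \<epsilon>\<close> by (simp add: power2_le_iff_abs_le)
  qed
  ultimately show ?thesis
    by (rule simple_eigentriple.sensitivity_nonneg[OF triple])
qed

text \<open>
  A tangent direction \<open>H\<close> is a limit of the inward directions \<open>H - \<delta> E\<close>, and so is \<open>-H\<close>.  The
  sensitivity is linear, hence nonnegative at both \<open>H\<close> and \<open>-H\<close>.
\<close>

lemma sensitivity_tangent_zero:
  fixes A :: "complex^'n^'n"
  assumes K: "K = UNIV \<or> K = \<real>" and "0 < \<epsilon>"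
    and E: "entries_in K E" "norm E = 1" and H: "entries_in K H" "E \<bullet> H = 0"
    and triple: "simple_eigentriple (A + \<epsilon> *\<^sub>R E) \<mu> x y (rmin K A \<epsilon>)"
  shows "simple_eigentriple.sensitivity (A + \<epsilon> *\<^sub>R E) \<mu> x y H = 0"
proof -
  interpret simple_eigentriple "A + \<epsilon> *\<^sub>R E" \<mu> x y "rmin K A \<epsilon>" by (rule triple)
  have *: "\<delta> * sensitivity E \<le> k * sensitivity H" if "0 < \<delta>" for \<delta> k
  proof -
    have "0 \<le> sensitivity (k *\<^sub>R H + (- \<delta>) *\<^sub>R E)"
    proof (rule sensitivity_nonneg_inward[OF K \<open>0 < \<epsilon>\<close> E _ _ triple])
      show "entries_in K (k *\<^sub>R H + (- \<delta>) *\<^sub>R E)"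
        by (rule entries_in_combination[OF K H(1) E(1)])
      show "E \<bullet> (k *\<^sub>R H + (- \<delta>) *\<^sub>R E) < 0"
        using H(2) E(2) that by (simp add: inner_simps dot_square_norm)
    qed
    then show ?thesis
      by (simp add: linear_add[OF linear_sensitivity] linear_cmul[OF linear_sensitivity]
          linear_diff[OF linear_sensitivity])
  qed
  have "0 \<le> k * sensitivity H" for k
  proof (rule tendsto_upperbound)
    show "((\<lambda>\<delta>. \<delta> * sensitivity E) \<longlongrightarrow> 0) (at_right 0)"
      by (rule tendsto_eq_intros refl | simp)+
    show "\<forall>\<^sub>F \<delta> in at_right 0. \<delta> * sensitivity E \<le> k * sensitivity H"
      by (auto simp: eventually_at_filter *)
  qed simp
  from this[of 1] this[of "- 1"] show ?thesis by simp
qed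

section \<open>Derivatives along a branch of minima\<close>

lemma unit_curve_orthogonal_derivative:
  fixes f :: "real \<Rightarrow> 'a::real_inner"
  assumes f: "(f has_vector_derivative f') (at t within S)"
    and unit: "\<And>s. s \<in> S \<Longrightarrow> norm (f s) = 1" and t: "t \<in> S" "at t within S \<noteq> bot"
  shows "f t \<bullet> f' = 0"
proof -
  have "((\<lambda>s. f s \<bullet> f s) has_vector_derivative f t \<bullet> f' + f' \<bullet> f t) (at t within S)"
    by (rule bounded_bilinear.has_vector_derivative[OF bounded_bilinear_inner f f])
  moreover have "((\<lambda>s. f s \<bullet> f s) has_vector_derivative 0) (at t within S)"
    by (rule has_vector_derivative_transform[of _ _ _ "\<lambda>_. 1"])
      (use unit t in \<open>auto simp: dot_square_norm\<close>)
  ultimately have "f t \<bullet> f' + f' \<bullet> f t = 0"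
    by (rule vector_derivative_unique_within[OF t(2)])
  then show ?thesis by (simp add: inner_commute)
qed

lemma entries_in_derivative:
  fixes F :: "real \<Rightarrow> complex^'n^'m"
  assumes K: "K = UNIV \<or> K = \<real>"
    and F: "(F has_vector_derivative F') (at t within S)"
    and entries: "\<And>s. s \<in> S \<Longrightarrow> entries_in K (F s)" and t: "t \<in> S" "at t within S \<noteq> bot"
  shows "entries_in K F'"
proof (cases "K = \<real>")
  case True
  have "Im (F' $ i $ j) = 0" for i j
  proof -
    have "bounded_linear (\<lambda>M :: complex^'n^'m. Im (M $ i $ j))"
      by (simp add: linear_conv_bounded_linear[symmetric] linear_iff)
    from bounded_linear.has_vector_derivative[OF this F]
    have "((\<lambda>s. Im (F s $ i $ j)) has_vector_derivative Im (F' $ i $ j)) (at t within S)" .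
    moreover have "((\<lambda>s. Im (F s $ i $ j)) has_vector_derivative 0) (at t within S)"
      by (rule has_vector_derivative_transform[of _ _ _ "\<lambda>_. 0"])
        (use entries t True in \<open>auto simp: entries_in_def complex_is_Real_iff\<close>)
    ultimately show ?thesis
      by (rule vector_derivative_unique_within[OF t(2)])
  qed
  then show ?thesis by (simp add: True entries_in_def complex_is_Real_iff)
qed (use K in \<open>auto simp: entries_in_def\<close>)

lemma antimono_on_has_real_derivative_nonpos:
  fixes f :: "real \<Rightarrow> real"
  assumes f: "(f has_real_derivative D) (at t within S)"
    and anti: "\<And>s u. s \<in> S \<Longrightarrow> u \<in> S \<Longrightarrow> s \<le> u \<Longrightarrow> f u \<le> f s"
    and t: "t \<in> S" "at t within S \<noteq> bot"
  shows "D \<le> 0"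
proof (rule tendsto_upperbound[OF _ _ t(2)])
  show "((\<lambda>s. (f s - f t) / (s - t)) \<longlongrightarrow> D) (at t within S)"
    using f by (simp add: has_field_derivative_iff)
  have "(f s - f t) / (s - t) \<le> 0" if "s \<in> S" for s
    using anti[OF that t(1)] anti[OF t(1) that]
    by (cases "s \<le> t") (auto simp: divide_le_0_iff)
  then show "\<forall>\<^sub>F s in at t within S. (f s - f t) / (s - t) \<le> 0"
    by (simp add: eventually_at_filter)
qed

lemma smooth_on_has_vector_derivative:
  assumes "smooth_on S f"
  obtains f' where "\<And>t. t \<in> S \<Longrightarrow> (f has_vector_derivative f' t) (at t within S)"
  using assms unfolding smooth_on_def by metis

text \<open>
  A positive minimum excludes orthogonal pairs of a right and a left eigenvector for one
  eigenvalue.  In a higher-dimensional eigenspace such a pair would exist, so unit eigenvectors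
  are unique up to a phase, and every normalised pair for \<open>\<mu>\<close> attains the minimum as soon as
  one does.
\<close>

lemma minimizer_simple_eigentriple:
  fixes A :: "complex^'n^'n"
  assumes pos: "0 < rmin K A \<epsilon>"
    and E: "entries_in K E" "norm E = 1"
    and min: "unit_eigenvectors (A + \<epsilon> *\<^sub>R E) \<mu> x0 y0" "hprod y0 x0 = of_real (rmin K A \<epsilon>)"
    and xy: "unit_eigenvectors (A + \<epsilon> *\<^sub>R E) \<mu> x y" "hprod y x \<in> \<real>" "0 < Re (hprod y x)"
  shows "simple_eigentriple (A + \<epsilon> *\<^sub>R E) \<mu> x y (rmin K A \<epsilon>)"
proof -
  let ?M = "A + \<epsilon> *\<^sub>R E"
  have x0: "?M *v x0 = \<mu> *s x0" "norm x0 = 1" and y0: "cadj ?M *v y0 = cnj \<mu> *s y0" "norm y0 = 1"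
    and x: "?M *v x = \<mu> *s x" "norm x = 1" and y: "cadj ?M *v y = cnj \<mu> *s y" "norm y = 1"
    using min(1) xy(1) by (auto simp: unit_eigenvectors_def left_eigenvector_iff_cadj)
  have nz: "u = 0 \<or> v = 0" if "?M *v u = \<mu> *s u" "cadj ?M *v v = cnj \<mu> *s v" "hprod v u = 0" for u v
  proof -
    have "rmin K A \<epsilon> * (norm u * norm v) \<le> 0"
      using rmin_le_on_sphere[OF E that(1,2)] that(3) by simp
    then have "norm u * norm v \<le> 0"
      using pos by (simp add: mult_le_0_iff)
    then show ?thesis by (auto simp: mult_le_0_iff)
  qed
  \<comment> \<open>\<open>w\<close> and \<open>z\<close> are eigenvectors orthogonal to \<open>y\<close> and to \<open>x0\<close>, hence zero.\<close>
  define w where "w = hprod y x0 *s x - hprod y x *s x0"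
  have "w = 0 \<or> y = 0"
    by (rule nz[OF _ y(1)])
      (simp_all add: w_def hprod_simps matrix_vector_mult_diff_distrib vector_scalar_commute x x0
        vector_smult_assoc vector_ssub_ldistrib mult_ac)
  then have "hprod y x0 *s x = hprod y x *s x0"
    using y(2) by (auto simp: w_def)
  from arg_cong[OF this, of norm] have 1: "cmod (hprod y x0) = cmod (hprod y x)"
    by (simp add: norm_smult x x0)
  define z where "z = hprod x0 y *s y0 - hprod x0 y0 *s y"
  have "hprod z x0 = 0"
    by (simp add: z_def hprod_simps cnj_hprod)
  then have "x0 = 0 \<or> z = 0"
    by (intro nz[OF x0(1)])
      (simp_all add: z_def matrix_vector_mult_diff_distrib vector_scalar_commute y y0
        vector_smult_assoc vector_ssub_ldistrib mult_ac)
  then have "hprod x0 y *s y0 = hprod x0 y0 *s y"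
    using x0(2) by (auto simp: z_def)
  from arg_cong[OF this, of norm] have 2: "cmod (hprod x0 y) = cmod (hprod x0 y0)"
    by (simp add: norm_smult y y0)
  have "cmod (hprod y x) = cmod (hprod y0 x0)"
    using 1 2 by (metis cnj_hprod complex_mod_cnj)
  then have "Re (hprod y x) = rmin K A \<epsilon>"
    using min(2) xy(2,3) pos by (auto elim!: Reals_cases)
  then have "hprod y x = of_real (rmin K A \<epsilon>)"
    using xy(2) by (auto elim!: Reals_cases)
  moreover have "w = 0" if "?M *v w = \<mu> *s w" "hprod y w = 0" for w
    using nz[OF that(1) y(1) that(2)] y(2) by auto
  ultimately show ?thesis
    using x y pos by (simp add: simple_eigentriple_def)
qed

theorem theorem7p1:
  fixes K :: "complex set" and A :: "complex^'n^'n" and a b :: real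
    and E :: "real \<Rightarrow> complex^'n^'n" and l :: "real \<Rightarrow> complex"
    and x y :: "real \<Rightarrow> complex^'n" and G :: "real \<Rightarrow> complex^'n^'n"
  assumes "K = UNIV \<or> K = \<real>"
    and "entries_in K A"
    and "card (spectrum A) = CARD('n)"
    and "0 < a" and "a < b"
    and "branch_of_minima K A {a..b} E l"
    and "\<forall>\<epsilon>\<in>{a..b}. rmin K A \<epsilon> > 0"
    and "smooth_on {a..b} x" and "smooth_on {a..b} y"
    and "\<forall>\<epsilon>\<in>{a..b}. unit_eigenvectors (A + \<epsilon> *\<^sub>R E \<epsilon>) (l \<epsilon>) (x \<epsilon>) (y \<epsilon>)"
    and "\<forall>\<epsilon>\<in>{a..b}. hprod (y \<epsilon>) (x \<epsilon>) \<in> \<real> \<and> Re (hprod (y \<epsilon>) (x \<epsilon>)) > 0"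
    and "\<forall>\<epsilon>\<in>{a..b}. G \<epsilon> = group_inverse (A + \<epsilon> *\<^sub>R E \<epsilon> - mat (l \<epsilon>))"
  shows "\<forall>\<epsilon>\<in>{a..b}.
    (rmin K A has_real_derivative
       rmin K A \<epsilon> * Re (hprod (x \<epsilon>) (G \<epsilon> *v (E \<epsilon> *v x \<epsilon>)) + hprod (y \<epsilon>) (E \<epsilon> *v (G \<epsilon> *v y \<epsilon>))))
      (at \<epsilon> within {a..b}) \<and>
    rmin K A \<epsilon> * Re (hprod (x \<epsilon>) (G \<epsilon> *v (E \<epsilon> *v x \<epsilon>)) + hprod (y \<epsilon>) (E \<epsilon> *v (G \<epsilon> *v y \<epsilon>))) \<le> 0"
proof
  fix \<epsilon> assume \<epsilon>: "\<epsilon> \<in> {a..b}"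
  let ?I = "{a..b}"
  note K = assms(1)
  have nontriv: "at \<epsilon> within ?I \<noteq> bot"
    using \<epsilon> \<open>a < b\<close> by (simp add: trivial_limit_within)
  have I_pos: "0 < t" if "t \<in> ?I" for t using that \<open>0 < a\<close> by simp
  have E: "entries_in K (E t)" "norm (E t) = 1" if "t \<in> ?I" for t
    using assms(6) that unfolding branch_of_minima_def by blast+
  have triple: "simple_eigentriple (A + t *\<^sub>R E t) (l t) (x t) (y t) (rmin K A t)" if t: "t \<in> ?I" for t
  proof -
    obtain x0 y0 where "unit_eigenvectors (A + t *\<^sub>R E t) (l t) x0 y0"
      "hprod y0 x0 = of_real (rmin K A t)"
      using assms(6) t unfolding branch_of_minima_def by blast
    then show ?thesis
      using assms(7,10,11) t by (intro minimizer_simple_eigentriple E) auto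
  qed
  note eig = simple_eigentriple.right[OF triple] simple_eigentriple.left[OF triple]
  note unit = simple_eigentriple.norm_x[OF triple] simple_eigentriple.norm_y[OF triple]
  obtain E' x' y' where E': "(E has_vector_derivative E') (at \<epsilon> within ?I)"
    and x': "(x has_vector_derivative x') (at \<epsilon> within ?I)"
    and y': "(y has_vector_derivative y') (at \<epsilon> within ?I)"
    using assms(6,8,9) \<epsilon> unfolding branch_of_minima_def
    by (meson smooth_on_has_vector_derivative)
  interpret simple_eigentriple "A + \<epsilon> *\<^sub>R E \<epsilon>" "l \<epsilon>" "x \<epsilon>" "y \<epsilon>" "rmin K A \<epsilon>"
    by (rule triple[OF \<epsilon>])
  define H where "H = E \<epsilon> + \<epsilon> *\<^sub>R E'"
  have M': "((\<lambda>t. A + t *\<^sub>R E t) has_vector_derivative H) (at \<epsilon> within ?I)"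
    unfolding H_def using E' by (auto intro!: derivative_eq_intros)
  have Madj': "((\<lambda>t. cadj (A + t *\<^sub>R E t)) has_vector_derivative cadj H) (at \<epsilon> within ?I)"
    using bounded_linear.has_vector_derivative[OF _ M', of cadj] linear_cadj
    by (simp add: linear_conv_bounded_linear)
  have "((\<lambda>t. (A + t *\<^sub>R E t) *v x t) has_vector_derivative
      (A + \<epsilon> *\<^sub>R E \<epsilon>) *v x' + H *v x \<epsilon>) (at \<epsilon> within ?I)"
    by (rule bounded_bilinear.has_vector_derivative[OF bounded_bilinear_mult_vec M' x'])
  \<comment> \<open>The eigenvalue is differentiable because it is the Rayleigh quotient \<open>x\<^sup>H (A + t E) x\<close>.\<close>
  from bounded_bilinear.has_vector_derivative[OF bounded_bilinear_hprod x' this]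
  obtain l' where "((\<lambda>t. hprod (x t) ((A + t *\<^sub>R E t) *v x t)) has_vector_derivative l') (at \<epsilon> within ?I)"
    by blast
  then have l': "(l has_vector_derivative l') (at \<epsilon> within ?I)"
    by (rule has_vector_derivative_transform[rotated 2])
      (use \<epsilon> in \<open>auto simp: eig hprod_self unit\<close>)
  have ladj': "((\<lambda>t. cnj (l t)) has_vector_derivative cnj l') (at \<epsilon> within ?I)"
    by (rule bounded_linear.has_vector_derivative[OF bounded_linear_cnj l'])
  have "N *v x' + H *v x \<epsilon> = l' *s x \<epsilon>"
    unfolding N_def
    by (rule differentiated_eigenvector_equation[OF M' x' l' _ \<epsilon> nontriv]) (rule eig)
  moreover have "cadj N *v y' + cadj H *v y \<epsilon> = cnj l' *s y \<epsilon>"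
    using differentiated_eigenvector_equation[OF Madj' y' ladj' _ \<epsilon> nontriv] eig
    by (simp add: N_def linear_diff[OF linear_cadj] cadj_mat)
  ultimately have "Re (hprod (y \<epsilon>) x' + hprod y' (x \<epsilon>)) =
      rmin K A \<epsilon> * (x \<epsilon> \<bullet> x' + y \<epsilon> \<bullet> y' + sensitivity H)"
    by (rule eigenvector_product_variation)
  also have "x \<epsilon> \<bullet> x' = 0"
    by (rule unit_curve_orthogonal_derivative[OF x' unit(1) \<epsilon> nontriv])
  also have "y \<epsilon> \<bullet> y' = 0"
    by (rule unit_curve_orthogonal_derivative[OF y' unit(2) \<epsilon> nontriv])
  also have "sensitivity H = sensitivity (E \<epsilon>) + \<epsilon> * sensitivity E'"
    by (simp add: H_def linear_add[OF linear_sensitivity] linear_cmul[OF linear_sensitivity])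
  \<comment> \<open>The minimizer moves tangentially to the sphere, so its motion does not contribute.\<close>
  also have "sensitivity E' = 0"
  proof (rule sensitivity_tangent_zero[OF K I_pos[OF \<epsilon>] E[OF \<epsilon>] _ _ triple[OF \<epsilon>]])
    show "entries_in K E'"
      by (rule entries_in_derivative[OF K E' E(1) \<epsilon> nontriv])
    show "E \<epsilon> \<bullet> E' = 0"
      by (rule unit_curve_orthogonal_derivative[OF E' E(2) \<epsilon> nontriv])
  qed
  finally have slope: "Re (hprod (y \<epsilon>) x' + hprod y' (x \<epsilon>)) = rmin K A \<epsilon> * sensitivity (E \<epsilon>)"
    by simp
  have "((\<lambda>t. Re (hprod (y t) (x t))) has_vector_derivative Re (hprod (y \<epsilon>) x' + hprod y' (x \<epsilon>)))
      (at \<epsilon> within ?I)"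
    by (intro bounded_linear.has_vector_derivative[OF bounded_linear_Re]
        bounded_bilinear.has_vector_derivative[OF bounded_bilinear_hprod] x' y')
  then have "(rmin K A has_vector_derivative rmin K A \<epsilon> * sensitivity (E \<epsilon>)) (at \<epsilon> within ?I)"
    unfolding slope
    by (rule has_vector_derivative_transform[rotated 2])
      (use \<epsilon> in \<open>auto simp: simple_eigentriple.hprod_yx[OF triple]\<close>)
  then have deriv: "(rmin K A has_real_derivative rmin K A \<epsilon> * sensitivity (E \<epsilon>)) (at \<epsilon> within ?I)"
    by (simp add: has_real_derivative_iff_has_vector_derivative)
  \<comment> \<open>The minimizer for \<open>s\<close> lies in the ball of radius \<open>t\<close>.\<close>
  have "rmin K A t \<le> rmin K A s" if "s \<in> ?I" "t \<in> ?I" "s \<le> t" for s t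
    using rmin_le_on_ball[OF K I_pos[OF that(2)] _ _ eig[OF that(1)]]
      E[OF that(1)] I_pos[OF that(1)] that K entries_in_combination[OF K E(1) E(1), of s s s 0]
      simple_eigentriple.r_pos[OF triple, of s]
    by (simp add: unit simple_eigentriple.hprod_yx[OF triple])
  then have "rmin K A \<epsilon> * sensitivity (E \<epsilon>) \<le> 0"
    using antimono_on_has_real_derivative_nonpos[OF deriv _ \<epsilon> nontriv] by blast
  moreover have "sensitivity (E \<epsilon>) =
      Re (hprod (x \<epsilon>) (G \<epsilon> *v (E \<epsilon> *v x \<epsilon>)) + hprod (y \<epsilon>) (E \<epsilon> *v (G \<epsilon> *v y \<epsilon>)))"
    using assms(12) \<epsilon> by (simp add: sensitivity_def \<Gamma>_def N_def)
  ultimately show "(rmin K A has_real_derivative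
       rmin K A \<epsilon> * Re (hprod (x \<epsilon>) (G \<epsilon> *v (E \<epsilon> *v x \<epsilon>)) + hprod (y \<epsilon>) (E \<epsilon> *v (G \<epsilon> *v y \<epsilon>))))
      (at \<epsilon> within {a..b}) \<and>
    rmin K A \<epsilon> * Re (hprod (x \<epsilon>) (G \<epsilon> *v (E \<epsilon> *v x \<epsilon>)) + hprod (y \<epsilon>) (E \<epsilon> *v (G \<epsilon> *v y \<epsilon>))) \<le> 0"
    using deriv by simp
qed

end
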